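(* For fixed $d$, $L=2\log(n)+(d-1)\log(\log(n))+\mathcal{O}(1)$ and $n$ large enough, it holds that $$Z_n(L,d)\ge 2^{n-1},$$ and hence the redundancy of the set $\mathcal{Z}_n(L,d)$ is at most a single bit.
   Context: All logarithms are base 2, and $n,d,L$ are positive integers. For $\mathbf{w}\in\{0,1\}^n$, $\mathbf{w}_{i,L}=(w_i,\dots,w_{i+L-1})$ denotes the length-$L$ substring starting at position $i$, and $d_H$ is the Hamming distance. A string $\mathbf{w}\in\{0,1\}^n$ is $(L,d)$-substring distant if $d_H(\mathbf{w}_{i,L},\mathbf{w}_{j,L})\ge d$ for all $1\le i<j\le n-L+1$. $\mathcal{Z}_n(L,d)$ is the set of all $(L,d)$-substring distant strings in $\{0,1\}^n$ and $Z_n(L,d)=|\mathcal{Z}_n(L,d)|$. The redundancy of $\mathcal{Z}_n(L,d)$ is $n-\log(Z_n(L,d))$.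
   Formalization: The O(1) term in L is taken to be bounded and at least a sufficiently large constant depending only on d, since for arbitrary bounded terms (for example d = 1 and L = 2 log n minus a large constant) the claim fails. *)

theory Defs
  imports Complex_Main "HOL-Library.Landau_Symbols"
begin

(* Binary strings are boolean lists; positions are counted from 0. *)

definition hamming_dist :: "'a list \<Rightarrow> 'a list \<Rightarrow> nat" where
  "hamming_dist u v = card {k. k < min (length u) (length v) \<and> u ! k \<noteq> v ! k}"

definition substring :: "'a list \<Rightarrow> nat \<Rightarrow> nat \<Rightarrow> 'a list" where
  "substring w i L = take L (drop i w)"

(* The bound j + L \<le> length w, free of truncated subtraction, says that the window at j
   fits into w; for L > length w the condition is void. *)
definition substring_distant :: "nat \<Rightarrow> nat \<Rightarrow> 'a list \<Rightarrow> bool" where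
  "substring_distant L d w \<longleftrightarrow>
     (\<forall>i j. i < j \<and> j + L \<le> length w \<longrightarrow>
        d \<le> hamming_dist (substring w i L) (substring w j L))"

definition sd_strings :: "nat \<Rightarrow> nat \<Rightarrow> nat \<Rightarrow> bool list set" where
  "sd_strings n L d = {w. length w = n \<and> substring_distant L d w}"

definition sd_count :: "nat \<Rightarrow> nat \<Rightarrow> nat \<Rightarrow> nat" where
  "sd_count n L d = card (sd_strings n L d)"

definition redundancy :: "nat \<Rightarrow> bool list set \<Rightarrow> real" where
  "redundancy n S = real n - log 2 (real (card S))"

end

theory Submission
  imports Defs "HOL-Real_Asymp.Real_Asymp"
begin

text \<open>
  A union bound. For \<open>i < j\<close> a string is determined by the set of positions at which its windows
  at \<open>i\<close> and \<open>j\<close> differ together with its letters outside the window at \<open>j\<close>, even if the windows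
  overlap: the missing letters are recovered from left to right. So at most
  \<open>2^(n-L) * (\<Sum>k<d. L choose k)\<close> strings have windows at distance less than \<open>d\<close> at \<open>i\<close> and \<open>j\<close>.
  There are at most \<open>n^2/2\<close> pairs, and \<open>L \<le> 3 log n\<close> bounds the sum by \<open>d (3 log n)^(d-1)\<close>, so
  the constant \<open>C = log (d 3^(d-1))\<close> makes the number of bad strings at most \<open>2^(n-1)\<close>.
\<close>

lemma hamming_dist_substring:
  assumes "i + L \<le> length w" "j + L \<le> length w"
  shows "hamming_dist (substring w i L) (substring w j L)
           = card {k. k < L \<and> w ! (i + k) \<noteq> w ! (j + k)}"
proof -
  have "{k. k < min (length (substring w i L)) (length (substring w j L)) \<and>
            substring w i L ! k \<noteq> substring w j L ! k}
        = {k. k < L \<and> w ! (i + k) \<noteq> w ! (j + k)}"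
    using assms by (auto simp: substring_def)
  then show ?thesis by (simp add: hamming_dist_def)
qed

text \<open>Strong induction on the position. Inside the window at \<open>j\<close>, a letter is
  fixed by an earlier letter together with whether the two agree; this inference is special to a
  binary alphabet.\<close>

lemma bool_list_eqI_window:
  fixes v w :: "bool list"
  assumes len: "length v = n" "length w = n" and ij: "i < j"
    and diff: "{k. k < L \<and> v ! (i + k) \<noteq> v ! (j + k)} = {k. k < L \<and> w ! (i + k) \<noteq> w ! (j + k)}"
    and pre: "take j v = take j w" and suf: "drop (j + L) v = drop (j + L) w"
  shows "v = w"
proof -
  have "m < n \<longrightarrow> v ! m = w ! m" for m
  proof (induction m rule: less_induct)
    case (less m)
    consider "m < j" | "j \<le> m" "m < j + L" | "j + L \<le> m" by linarith
    then show ?case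
    proof cases
      case 1
      then show ?thesis using pre by (metis nth_take)
    next
      case 2
      define k where "k = m - j"
      have k: "k < L" "m = j + k" using 2 by (auto simp: k_def)
      have "v ! (i + k) \<noteq> v ! (j + k) \<longleftrightarrow> w ! (i + k) \<noteq> w ! (j + k)"
        using diff k(1) by blast
      \<comment> \<open>Since \<open>i < j\<close>, position \<open>i + k\<close> precedes
        \<open>m = j + k\<close>, so the induction hypothesis applies even if \<open>i + k\<close>
        itself lies in the window at \<open>j\<close>.\<close>
      moreover have "m < n \<longrightarrow> v ! (i + k) = w ! (i + k)"
        using less.IH[of "i + k"] ij k by auto
      ultimately show ?thesis using k by auto
    next
      case 3
      show ?thesis
      proof
        assume "m < n"
        then have "drop (j + L) v ! (m - (j + L)) = v ! m" "drop (j + L) w ! (m - (j + L)) = w ! m"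
          using 3 len by auto
        then show "v ! m = w ! m" using suf by simp
      qed
    qed
  qed
  then show ?thesis using len by (auto intro: nth_equalityI)
qed

lemma card_subsets_card_less:
  "card {A. A \<subseteq> {..<L::nat} \<and> card A < d} \<le> (\<Sum>k<d. L choose k)"
proof -
  have "{A. A \<subseteq> {..<L} \<and> card A < d} = (\<Union>k<d. {A. A \<subseteq> {..<L} \<and> card A = k})"
    by auto
  then have "card {A. A \<subseteq> {..<L} \<and> card A < d} \<le> (\<Sum>k<d. card {A. A \<subseteq> {..<L} \<and> card A = k})"
    by (simp add: card_UN_le)
  also have "\<dots> = (\<Sum>k<d. L choose k)"
    by (intro sum.cong refl) (simp add: n_subsets)
  finally show ?thesis .
qed

lemma card_bool_lists: "card {w :: bool list. length w = n} = 2 ^ n"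
  using card_lists_length_eq[of "UNIV :: bool set" n] by simp

lemma finite_bool_lists: "finite {w :: bool list. length w = n}"
  using finite_lists_length_eq[of "UNIV :: bool set" n] by simp

text \<open>Injects the close strings into pairs of a mismatch set of fewer than \<open>d\<close>
  positions and a string of the \<open>n - L\<close> letters outside the window at
  \<open>j\<close>.\<close>

lemma card_close_windows:
  assumes ij: "i < j" and fits: "j + L \<le> n"
  shows "card {w :: bool list. length w = n \<and>
              hamming_dist (substring w i L) (substring w j L) < d}
         \<le> 2 ^ (n - L) * (\<Sum>k<d. L choose k)"
    (is "card ?B \<le> _")
proof -
  let ?D = "\<lambda>w :: bool list. {k. k < L \<and> w ! (i + k) \<noteq> w ! (j + k)}"
  let ?f = "\<lambda>w. (?D w, take j w @ drop (j + L) w)"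
  let ?S = "{A. A \<subseteq> {..<L} \<and> card A < d}" and ?W = "{w :: bool list. length w = n - L}"
  have "inj_on ?f ?B"
  proof (rule inj_onI)
    fix v w assume v: "v \<in> ?B" and w: "w \<in> ?B" and eq: "?f v = ?f w"
    have "take j v = take j w \<and> drop (j + L) v = drop (j + L) w"
      using v w eq fits by simp
    then show "v = w"
      using bool_list_eqI_window[of v n w i j L] v w eq ij by simp
  qed
  moreover have "?f ` ?B \<subseteq> ?S \<times> ?W"
  proof (rule image_subsetI)
    fix w assume w: "w \<in> ?B"
    then have "hamming_dist (substring w i L) (substring w j L) = card (?D w)"
      using ij fits by (intro hamming_dist_substring) auto
    then show "?f w \<in> ?S \<times> ?W" using w fits by auto
  qed
  moreover have "finite (?S \<times> ?W)"
    by (intro finite_cartesian_product finite_bool_lists finite_subset[of ?S "Pow {..<L}"]) auto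
  ultimately have "card ?B \<le> card (?S \<times> ?W)" by (rule card_inj_on_le)
  also have "\<dots> = 2 ^ (n - L) * card ?S"
    by (simp add: card_cartesian_product card_bool_lists)
  also have "\<dots> \<le> 2 ^ (n - L) * (\<Sum>k<d. L choose k)"
    by (intro mult_left_mono card_subsets_card_less) simp
  finally show ?thesis .
qed

text \<open>Counting only ordered pairs \<open>i < j\<close> gains the factor 2 that later makes the
  bad strings at most half of all strings.\<close>

lemma card_pairs_less: "2 * card (SIGMA j:{..<n::nat}. {..<j}) \<le> n ^ 2"
proof -
  have "2 * (\<Sum>j<n. j) \<le> n ^ 2"
    by (induction n) (auto simp: power2_eq_square)
  then show ?thesis by simp
qed

lemma card_not_substring_distant:
  assumes "L > 0"
  shows "2 * card {w :: bool list. length w = n \<and> \<not> substring_distant L d w}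
           \<le> n ^ 2 * (2 ^ (n - L) * (\<Sum>k<d. L choose k))"
    (is "2 * card ?N \<le> n ^ 2 * ?K")
proof -
  \<comment> \<open>With \<open>j + L \<le> n\<close> placed inside the set, pairs whose window does
    not fit contribute the empty set, and the index set depends on \<open>n\<close> alone.\<close>
  let ?B = "\<lambda>(j, i). {w :: bool list. length w = n \<and> j + L \<le> n \<and>
              hamming_dist (substring w i L) (substring w j L) < d}"
  let ?P = "SIGMA j:{..<n}. {..<j}"
  \<comment> \<open>Here \<open>L > 0\<close> turns \<open>j + L \<le> n\<close> into
    \<open>j < n\<close>.\<close>
  have sub: "?N \<subseteq> (\<Union>p\<in>?P. ?B p)"
    using assms by (fastforce simp: substring_distant_def not_le)
  have fin: "finite (\<Union>p\<in>?P. ?B p)"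
    by (rule finite_subset[OF _ finite_bool_lists[of n]]) auto
  have "card (?B p) \<le> ?K" if "p \<in> ?P" for p
  proof (cases "fst p + L \<le> n")
    case True
    then show ?thesis
      using that card_close_windows[of "snd p" "fst p" L n d] by (auto simp: case_prod_beta)
  next
    case False
    then show ?thesis by (simp add: case_prod_beta)
  qed
  then have "(\<Sum>p\<in>?P. card (?B p)) \<le> card ?P * ?K"
    using sum_bounded_above[of ?P "\<lambda>p. card (?B p)" ?K] by simp
  moreover have "card ?N \<le> (\<Sum>p\<in>?P. card (?B p))"
    by (rule order_trans[OF card_mono[OF fin sub] card_UN_le]) simp
  ultimately have "2 * card ?N \<le> 2 * card ?P * ?K" by linarith
  also have "\<dots> \<le> n ^ 2 * ?K"
    by (intro mult_right_mono card_pairs_less) simp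
  finally show ?thesis .
qed

text \<open>Each of the \<open>d\<close> terms is at most \<open>L ^ k\<close>, hence at most
  \<open>M ^ (d - 1)\<close> because \<open>1 \<le> M\<close>. A real \<open>M\<close> allows the
  later choice of three times the logarithm of \<open>n\<close>.\<close>

lemma sum_binomial_le:
  fixes M :: real
  assumes "real L \<le> M" "1 \<le> M" "d \<ge> 1"
  shows "real (\<Sum>k<d. L choose k) \<le> real d * M ^ (d - 1)"
proof -
  have "real (L choose k) \<le> M ^ (d - 1)" if "k < d" for k
  proof -
    have "real (L choose k) \<le> real L ^ k"
    proof (cases "k \<le> L")
      case True
      then have "L choose k \<le> L ^ k" by (rule binomial_le_pow)
      then show ?thesis by (metis of_nat_le_iff of_nat_power)
    qed (simp add: binomial_eq_0)
    also have "\<dots> \<le> M ^ k" using assms by (intro power_mono) auto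
    also have "\<dots> \<le> M ^ (d - 1)" using assms that by (intro power_increasing) auto
    finally show ?thesis .
  qed
  then show ?thesis
    using sum_bounded_above[of "{..<d}" "\<lambda>k. real (L choose k)" "M ^ (d - 1)"] by simp
qed

lemma sd_count_ge:
  fixes d L n :: nat
  defines "l \<equiv> log 2 (real n)"
  assumes d: "d \<ge> 1" and n: "n \<ge> 2" and L: "L > 0" and upper: "real L \<le> 3 * l"
    and lower: "real L \<ge> 2 * l + (real d - 1) * log 2 l + log 2 (real d * 3 ^ (d - 1))"
  shows "2 ^ (n - 1) \<le> sd_count n L d"
proof (cases "L \<le> n")
  case False
  then have "sd_strings n L d = {w. length w = n}"
    by (auto simp: sd_strings_def substring_distant_def)
  then show ?thesis by (simp add: sd_count_def card_bool_lists)
next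
  case True
  let ?N = "{w :: bool list. length w = n \<and> \<not> substring_distant L d w}"
  let ?S = "real (\<Sum>k<d. L choose k)"
  have l1: "l \<ge> 1" using n by (simp add: l_def)
  have "real n ^ 2 * ?S \<le> real n ^ 2 * (real d * (3 * l) ^ (d - 1))"
    using upper l1 d by (intro mult_left_mono sum_binomial_le) auto
  \<comment> \<open>Written as a power of two, the bound has exactly the right-hand side of
    \<open>lower\<close> as its exponent.\<close>
  also have "\<dots> = 2 powr (2 * l + (real d - 1) * log 2 l + log 2 (real d * 3 ^ (d - 1)))"
  proof -
    have "2 powr (2 * l) = real n ^ 2"
      using n by (simp add: l_def powr_powr[symmetric] mult.commute[of 2] powr_numeral)
    moreover have "2 powr ((real d - 1) * log 2 l) = l ^ (d - 1)"
      using l1 d by (simp add: powr_powr[symmetric] mult.commute[of "real d - 1"]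
          powr_realpow[symmetric] of_nat_diff)
    moreover have "2 powr (log 2 (real d * 3 ^ (d - 1))) = real d * 3 ^ (d - 1)"
      using d by (intro powr_log_cancel) auto
    ultimately show ?thesis by (simp add: powr_add power_mult_distrib)
  qed
  also have "\<dots> \<le> 2 powr real L" using lower by (intro powr_mono) auto
  also have "\<dots> = 2 ^ L" by (simp add: powr_realpow)
  finally have key: "real n ^ 2 * ?S \<le> 2 ^ L" .
  have "2 * real (card ?N) \<le> real n ^ 2 * (2 ^ (n - L) * ?S)"
    using card_not_substring_distant[OF L, of n d]
    by (metis (no_types, lifting) of_nat_le_iff of_nat_mult of_nat_numeral of_nat_power)
  also have "\<dots> = 2 ^ (n - L) * (real n ^ 2 * ?S)" by simp
  also have "\<dots> \<le> 2 ^ (n - L) * 2 ^ L" by (intro mult_left_mono key) simp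
  \<comment> \<open>The case assumption \<open>L \<le> n\<close> rules out truncation in
    \<open>n - L\<close>.\<close>
  also have "\<dots> = 2 ^ n" using True by (simp flip: power_add)
  finally have "2 * card ?N \<le> 2 ^ n"
    by (metis (no_types, lifting) of_nat_le_iff of_nat_mult of_nat_numeral of_nat_power)
  moreover have "card (sd_strings n L d) + card ?N = 2 ^ n"
  proof -
    have "card (sd_strings n L d \<union> ?N) = card (sd_strings n L d) + card ?N"
      by (rule card_Un_disjoint; (rule finite_subset[OF _ finite_bool_lists[of n]])?)
        (auto simp: sd_strings_def)
    moreover have "sd_strings n L d \<union> ?N = {w. length w = n}" by (auto simp: sd_strings_def)
    ultimately show ?thesis by (simp add: card_bool_lists)
  qed
  moreover have "(2::nat) ^ n = 2 * 2 ^ (n - 1)" using n by (simp add: power_eq_if)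
  ultimately show ?thesis unfolding sd_count_def by linarith
qed

lemma redundancy_le_1:
  assumes "2 ^ (n - 1) \<le> sd_count n L d" "n \<ge> 1"
  shows "redundancy n (sd_strings n L d) \<le> 1"
proof -
  have "real n - 1 = log 2 (2 ^ (n - 1))" using assms(2) by (simp add: log_nat_power of_nat_diff)
  also have "\<dots> \<le> log 2 (real (card (sd_strings n L d)))"
  proof (rule log_mono)
    show "(2::real) ^ (n - 1) \<le> real (card (sd_strings n L d))"
      using assms(1) unfolding sd_count_def
      by (metis of_nat_le_iff of_nat_numeral of_nat_power)
  qed auto
  finally show ?thesis by (simp add: redundancy_def)
qed

text \<open>The O(1) term is read as bounded, and eventually at least a constant \<open>C\<close>
  that is chosen before \<open>L\<close>. Boundedness supplies the upper estimate on
  \<open>L n\<close>, the second hypothesis the lower one.\<close>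

theorem lemma18:
  fixes d :: nat
  assumes "d \<ge> 1"
  shows "\<exists>C::real. \<forall>L :: nat \<Rightarrow> nat.
    (\<lambda>n. real (L n) - (2 * log 2 (real n) + (real d - 1) * log 2 (log 2 (real n))))
        \<in> O(\<lambda>n. 1) \<longrightarrow>
    (\<forall>\<^sub>F n in sequentially.
        real (L n) \<ge> 2 * log 2 (real n) + (real d - 1) * log 2 (log 2 (real n)) + C) \<longrightarrow>
    (\<forall>\<^sub>F n in sequentially.
        sd_count n (L n) d \<ge> 2 ^ (n - 1) \<and> redundancy n (sd_strings n (L n) d) \<le> 1)"
proof (intro exI[of _ "log 2 (real d * 3 ^ (d - 1))"] allI impI)
  fix L :: "nat \<Rightarrow> nat"
  define D where "D = real d - 1"
  define C where "C = log 2 (real d * 3 ^ (d - 1))"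
  assume "(\<lambda>n. real (L n) - (2 * log 2 (real n) + (real d - 1) * log 2 (log 2 (real n))))
            \<in> O(\<lambda>n. 1)"
  then obtain K where K: "\<forall>\<^sub>F n in sequentially.
      norm (real (L n) - (2 * log 2 (real n) + D * log 2 (log 2 (real n)))) \<le> K"
    by (auto elim!: landau_o.bigE simp: D_def)
  assume lower: "\<forall>\<^sub>F n in sequentially. real (L n) \<ge>
      2 * log 2 (real n) + (real d - 1) * log 2 (log 2 (real n)) + log 2 (real d * 3 ^ (d - 1))"
  \<comment> \<open>The lower-order terms are absorbed by one extra logarithm; together with
    \<open>K\<close> this gives \<open>L n \<le> 3 * log 2 n\<close>.\<close>
  have small: "\<forall>\<^sub>F n in sequentially. D * log 2 (log 2 (real n)) + K \<le> log 2 (real n)"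
    by real_asymp
  \<comment> \<open>Combined with \<open>lower\<close>, this yields the positivity of
    \<open>L n\<close> that \<open>sd_count_ge\<close> requires.\<close>
  have pos: "\<forall>\<^sub>F n in sequentially. 0 < 2 * log 2 (real n) + D * log 2 (log 2 (real n)) + C"
    by real_asymp
  show "\<forall>\<^sub>F n in sequentially.
      sd_count n (L n) d \<ge> 2 ^ (n - 1) \<and> redundancy n (sd_strings n (L n) d) \<le> 1"
    using K lower small pos eventually_ge_at_top[of 2]
  proof eventually_elim
    case (elim n)
    have "real (L n) > 0" using elim(2,4) unfolding C_def D_def by linarith
    moreover have "real (L n) \<le> 3 * log 2 (real n)" using elim(1,3) by (simp add: abs_le_iff)
    ultimately have "2 ^ (n - 1) \<le> sd_count n (L n) d"
      using elim(2,5) assms by (intro sd_count_ge) auto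
    then show ?case using elim(5) redundancy_le_1 by simp
  qed
qed

end
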